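(* Let $\alpha\in\mathcal{ODP}_n$ with $f(\alpha)\ge 1$ (i.e. $\alpha$ has at least one fixed point). Then $\alpha$ is an idempotent.
   Context: For $n\ge 0$ let $X_n=\{1,2,\dots,n\}$ and let $\mathcal{I}_n$ be the symmetric inverse semigroup of all partial injective maps of $X_n$ (including the empty map) under composition of partial maps. $\mathcal{ODP}_n$ is the subsemigroup of all $\alpha\in\mathcal{I}_n$ such that for all $x,y\in\mathrm{Dom}\,\alpha$, $|x-y|=|x\alpha-y\alpha|$, and $x\le y$ implies $x\alpha\le y\alpha$ (order-preserving partial isometries; $x\alpha$ denotes the image of $x$ under $\alpha$). $f(\alpha)=|F(\alpha)|$ where $F(\alpha)=\{x\in\mathrm{Dom}\,\alpha: x\alpha=x\}$. *)

theory Defs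
  imports Main
begin

text \<open>Partial maps of \<open>X\<^sub>n\<close> are represented as \<open>nat \<rightharpoonup> nat\<close>
  with domain and range inside \<open>X n\<close>.\<close>

definition X :: "nat \<Rightarrow> nat set" where
  "X n = {1..n}"

definition sym_inv_semigroup :: "nat \<Rightarrow> (nat \<rightharpoonup> nat) set" where
  "sym_inv_semigroup n = {\<alpha>. dom \<alpha> \<subseteq> X n \<and> ran \<alpha> \<subseteq> X n \<and> inj_on \<alpha> (dom \<alpha>)}"

text \<open>Maps act on the right in the mathematical source, so the product \<open>\<alpha>\<beta>\<close>
  (first \<open>\<alpha>\<close>, then \<open>\<beta>\<close>) is \<open>\<beta> \<circ>\<^sub>m \<alpha>\<close>.\<close>

definition pmult :: "('a \<rightharpoonup> 'a) \<Rightarrow> ('a \<rightharpoonup> 'a) \<Rightarrow> ('a \<rightharpoonup> 'a)" where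
  "pmult \<alpha> \<beta> = \<beta> \<circ>\<^sub>m \<alpha>"

definition idempotent :: "('a \<rightharpoonup> 'a) \<Rightarrow> bool" where
  "idempotent \<alpha> \<longleftrightarrow> pmult \<alpha> \<alpha> = \<alpha>"

text \<open>Distances are taken in \<open>int\<close>, since subtraction on \<open>nat\<close> truncates.\<close>

definition partial_isometry :: "(nat \<rightharpoonup> nat) \<Rightarrow> bool" where
  "partial_isometry \<alpha> \<longleftrightarrow>
     (\<forall>x\<in>dom \<alpha>. \<forall>y\<in>dom \<alpha>. \<bar>int x - int y\<bar> = \<bar>int (the (\<alpha> x)) - int (the (\<alpha> y))\<bar>)"

definition order_preserving :: "(nat \<rightharpoonup> nat) \<Rightarrow> bool" where
  "order_preserving \<alpha> \<longleftrightarrow>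
     (\<forall>x\<in>dom \<alpha>. \<forall>y\<in>dom \<alpha>. x \<le> y \<longrightarrow> the (\<alpha> x) \<le> the (\<alpha> y))"

definition ODP :: "nat \<Rightarrow> (nat \<rightharpoonup> nat) set" where
  "ODP n = {\<alpha> \<in> sym_inv_semigroup n. partial_isometry \<alpha> \<and> order_preserving \<alpha>}"

definition Fix :: "('a \<rightharpoonup> 'a) \<Rightarrow> 'a set" where
  "Fix \<alpha> = {x \<in> dom \<alpha>. the (\<alpha> x) = x}"

definition num_fix :: "('a \<rightharpoonup> 'a) \<Rightarrow> nat" where
  "num_fix \<alpha> = card (Fix \<alpha>)"

end

theory Submission
  imports Defs
begin

text \<open>A fixed point \<open>a\<close> pins down the whole map: an isometry fixing
  \<open>a\<close> sends x either to x or to its mirror image 2a - x, and preserving order keeps the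
  image on the same side of \<open>a\<close>, which rules out a proper reflection. So
  \<open>\<alpha>\<close> is a partial identity, hence idempotent.\<close>

lemma ODP_fixed_point_imp_identity:
  assumes "\<alpha> \<in> ODP n" and "a \<in> Fix \<alpha>" and "\<alpha> x = Some y"
  shows "y = x"
proof -
  have a: "\<alpha> a = Some a"
    using assms(2) by (auto simp: Fix_def)
  have iso: "\<bar>int x - int a\<bar> = \<bar>int y - int a\<bar>"
    using assms(1,3) a by (force simp: ODP_def partial_isometry_def)
  have ord: "x \<le> a \<Longrightarrow> y \<le> a" "a \<le> x \<Longrightarrow> a \<le> y"
    using assms(1,3) a by (force simp: ODP_def order_preserving_def)+
  show ?thesis
    using iso ord by linarith
qed

theorem lemma1p6:
  fixes n :: nat and \<alpha> :: "nat \<rightharpoonup> nat"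
  assumes "\<alpha> \<in> ODP n"
    and "num_fix \<alpha> \<ge> 1"
  shows "idempotent \<alpha>"
proof -
  have "Fix \<alpha> \<noteq> {}"
    using assms(2) by (auto simp: num_fix_def)
  then obtain a where a: "a \<in> Fix \<alpha>"
    by blast
  \<comment> \<open>Off the domain both sides are \<open>None\<close>; on it the first application
    returns x itself, so the second repeats it.\<close>
  have "(\<alpha> \<circ>\<^sub>m \<alpha>) x = \<alpha> x" for x
  proof (cases "\<alpha> x")
    case (Some y)
    with ODP_fixed_point_imp_identity[OF assms(1) a] show ?thesis
      by auto
  qed simp
  then show ?thesis
    by (auto simp: idempotent_def pmult_def)
qed

end
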